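(* Let $c\in\mathbb{C}$ with $|c|=1$, let $X$ and $E$ be complex Banach spaces, and let $I=\mathbb{R}$ or $I=[0,\infty)$. Suppose that $F:I\times X\to E$ is a continuous function and that there exists a finite constant $L>0$ such that $$\|F(t,x)-F(t,y)\|\le L\|x-y\|_X,\qquad t\in I,\ x,y\in X.$$ (i) Suppose that $f:I\to X$ is $c$-uniformly recurrent. If there exists a strictly increasing sequence $(\alpha_n)$ of positive reals tending to plus infinity such that $$\lim_{n\to+\infty}\sup_{t\in I}\|f(t+\alpha_n)-cf(t)\|=0\quad\text{and}\quad \lim_{n\to+\infty}\sup_{t\in I}\|F(t+\alpha_n,cf(t))-cF(t,f(t))\|=0,$$ then the mapping $\mathcal{F}(t):=F(t,f(t))$, $t\in I$, is $c$-uniformly recurrent. (ii) Suppose that $f:I\to X$ is $c$-almost periodic. If for each $\epsilon>0$ the set of all positive real numbers $\tau>0$ such that $$\sup_{t\in I}\|f(t+\tau)-cf(t)\|<\epsilon\quad\text{and}\quad \sup_{t\in I}\|F(t+\tau,cf(t))-cF(t,f(t))\|<\epsilon$$ is relatively dense in $[0,\infty)$, then the mapping $\mathcal{F}(t):=F(t,f(t))$, $t\in I$, is $c$-almost periodic.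
   Context: A subset $A\subseteq[0,\infty)$ is relatively dense in $[0,\infty)$ if there exists $l>0$ such that every subinterval of $[0,\infty)$ of length $l$ meets $A$. Let $Y$ be a complex Banach space and $g:I\to Y$ a continuous function. $g$ is $c$-almost periodic if for each $\epsilon>0$ the set of all $\tau>0$ such that $\|g(t+\tau)-cg(t)\|\le\epsilon$ for all $t\in I$ is relatively dense in $[0,\infty)$. $g$ is $c$-uniformly recurrent if there exists a strictly increasing sequence $(\alpha_n)$ of positive reals with $\alpha_n\to+\infty$ and $\lim_{n\to\infty}\sup_{t\in I}\|g(t+\alpha_n)-cg(t)\|=0$. *)

theory Defs
  imports "HOL-Analysis.Analysis"
begin

(* HOL-Analysis only provides real normed spaces; a complex one is a real one with a
   compatible complex scalar multiplication. *)

class complex_normed_vector = real_normed_vector +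
  fixes scaleC :: "complex \<Rightarrow> 'a \<Rightarrow> 'a"  (infixr "*\<^sub>C" 75)
  assumes scaleC_add_right: "a *\<^sub>C (x + y) = a *\<^sub>C x + a *\<^sub>C y"
    and scaleC_add_left: "(a + b) *\<^sub>C x = a *\<^sub>C x + b *\<^sub>C x"
    and scaleC_scaleC: "a *\<^sub>C (b *\<^sub>C x) = (a * b) *\<^sub>C x"
    and scaleC_one: "1 *\<^sub>C x = x"
    and scaleR_scaleC: "scaleR r x = complex_of_real r *\<^sub>C x"
    and norm_scaleC: "norm (a *\<^sub>C x) = cmod a * norm x"

class complex_banach = complex_normed_vector + banach

instantiation complex :: complex_banach
begin

definition scaleC_complex :: "complex \<Rightarrow> complex \<Rightarrow> complex"
  where "scaleC_complex a x = a * x"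

instance
  by standard (simp_all add: scaleC_complex_def algebra_simps norm_mult scaleR_conv_of_real)

end

definition relatively_dense :: "real set \<Rightarrow> bool"
  where "relatively_dense A \<longleftrightarrow>
    A \<subseteq> {0..} \<and> (\<exists>l>0. \<forall>a\<ge>0. {a..a + l} \<inter> A \<noteq> {})"

(* A function on a domain I is a total function on the reals, used only on I. *)

definition c_almost_periodic ::
    "complex \<Rightarrow> real set \<Rightarrow> (real \<Rightarrow> 'a::complex_banach) \<Rightarrow> bool"
  where "c_almost_periodic c I g \<longleftrightarrow>
    continuous_on I g \<and>
    (\<forall>\<epsilon>>0. relatively_dense {\<tau>. \<tau> > 0 \<and> (\<forall>t\<in>I. norm (g (t + \<tau>) - c *\<^sub>C g t) \<le> \<epsilon>)})"

(* Suprema are taken in the extended reals, since on type real the supremum of an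
   unbounded set is unspecified. *)

definition c_uniformly_recurrent ::
    "complex \<Rightarrow> real set \<Rightarrow> (real \<Rightarrow> 'a::complex_banach) \<Rightarrow> bool"
  where "c_uniformly_recurrent c I g \<longleftrightarrow>
    continuous_on I g \<and>
    (\<exists>\<alpha> :: nat \<Rightarrow> real. strict_mono \<alpha> \<and> (\<forall>n. \<alpha> n > 0) \<and> filterlim \<alpha> at_top sequentially \<and>
      (\<lambda>n. SUP t\<in>I. ereal (norm (g (t + \<alpha> n) - c *\<^sub>C g t))) \<longlonglongrightarrow> 0)"

end

theory Submission imports Defs begin

text \<open>
  Write \<open>G t = F (t, f t)\<close>. The shifted difference of \<open>G\<close> splits at the intermediate point
  \<open>F (t + \<tau>, c *\<^sub>C f t)\<close>: there the time argument has been moved but \<open>f\<close> has not yet been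
  evaluated at the new time. The first part is a difference of values of \<open>F\<close> at the same time,
  so the Lipschitz condition bounds it by \<open>L\<close> times the shifted difference of \<open>f\<close>; the second
  part is the quantity that the hypotheses on \<open>F\<close> control. Hence, with \<open>L\<close> independent of
  \<open>t\<close> and \<open>\<tau>\<close>, one gets the bound \<open>norm_superposition_shift_le\<close>. Here \<open>t + \<tau>\<close> must lie in
  \<open>I\<close>, which holds for \<open>\<tau> > 0\<close> on the line and on the half-line.

  For part (i), the bound is taken along the given sequence \<open>\<alpha>\<close>, and
  \<open>tendsto_SUP_zero_of_le_lincomb\<close> passes to suprema over \<open>t\<close> and to the limit. For part
  (ii), every \<open>\<tau>\<close> that is admissible for \<open>f\<close> and \<open>F\<close> with tolerance \<open>\<epsilon> / (L + 1)\<close> is an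
  admissible shift for \<open>G\<close> with tolerance \<open>\<epsilon>\<close>, and a set of nonnegative reals that contains
  a relatively dense one is relatively dense.
\<close>

lemma relatively_dense_mono:
  assumes "relatively_dense A" "A \<subseteq> B" "B \<subseteq> {0..}"
  shows "relatively_dense B"
proof -
  from assms(1) obtain l where "l > 0" and l: "\<And>a. a \<ge> 0 \<Longrightarrow> {a..a + l} \<inter> A \<noteq> {}"
    unfolding relatively_dense_def by auto
  have "{a..a + l} \<inter> B \<noteq> {}" if "a \<ge> 0" for a
    using l[OF that] assms(2) by blast
  with \<open>l > 0\<close> assms(3) show ?thesis
    unfolding relatively_dense_def by auto
qed

text \<open>Triangle inequality through \<open>F (t + \<tau>, c *\<^sub>C f t)\<close>: both arguments of the Lipschitz
  estimate are taken at the shifted time \<open>t + \<tau>\<close>.\<close>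

lemma norm_superposition_shift_le:
  fixes f :: "real \<Rightarrow> 'x::complex_banach" and F :: "real \<times> 'x \<Rightarrow> 'e::complex_banach"
  assumes "\<forall>x y. norm (F (t + \<tau>, x) - F (t + \<tau>, y)) \<le> L * norm (x - y)"
  shows "norm (F (t + \<tau>, f (t + \<tau>)) - c *\<^sub>C F (t, f t))
    \<le> L * norm (f (t + \<tau>) - c *\<^sub>C f t) + norm (F (t + \<tau>, c *\<^sub>C f t) - c *\<^sub>C F (t, f t))"
proof -
  have "norm (F (t + \<tau>, f (t + \<tau>)) - c *\<^sub>C F (t, f t))
    \<le> norm (F (t + \<tau>, f (t + \<tau>)) - F (t + \<tau>, c *\<^sub>C f t))
      + norm (F (t + \<tau>, c *\<^sub>C f t) - c *\<^sub>C F (t, f t))"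
    using norm_triangle_ineq[of "F (t + \<tau>, f (t + \<tau>)) - F (t + \<tau>, c *\<^sub>C f t)"
        "F (t + \<tau>, c *\<^sub>C f t) - c *\<^sub>C F (t, f t)"] by simp
  also have "\<dots> \<le> L * norm (f (t + \<tau>) - c *\<^sub>C f t)
      + norm (F (t + \<tau>, c *\<^sub>C f t) - c *\<^sub>C F (t, f t))"
    using assms by (intro add_right_mono) blast
  finally show ?thesis .
qed

lemma continuous_on_superposition:
  fixes f :: "real \<Rightarrow> 'x::topological_space"
  assumes "continuous_on (I \<times> UNIV) F" "continuous_on I f"
  shows "continuous_on I (\<lambda>t. F (t, f t))"
  by (rule continuous_on_compose2[OF assms(1)]) (auto intro!: continuous_intros assms(2))

text \<open>The extended-real form of the sandwich argument: the suprema may be infinite for some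
  \<open>n\<close>, but multiplication by the finite constant \<open>L\<close> and addition are still continuous at the
  limit \<open>0\<close>.\<close>

lemma tendsto_SUP_zero_of_le_lincomb:
  fixes u v w :: "nat \<Rightarrow> 'a \<Rightarrow> real"
  assumes "I \<noteq> {}" "L \<ge> 0"
    and nonneg: "\<And>n t. t \<in> I \<Longrightarrow> 0 \<le> w n t"
    and le: "\<And>n t. t \<in> I \<Longrightarrow> w n t \<le> L * u n t + v n t"
    and u: "(\<lambda>n. SUP t\<in>I. ereal (u n t)) \<longlonglongrightarrow> 0"
    and v: "(\<lambda>n. SUP t\<in>I. ereal (v n t)) \<longlonglongrightarrow> 0"
  shows "(\<lambda>n. SUP t\<in>I. ereal (w n t)) \<longlonglongrightarrow> 0"
proof (rule tendsto_sandwich[OF _ _ tendsto_const])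
  let ?U = "\<lambda>n. SUP t\<in>I. ereal (u n t)" and ?V = "\<lambda>n. SUP t\<in>I. ereal (v n t)"
  show "\<forall>\<^sub>F n in sequentially. 0 \<le> (SUP t\<in>I. ereal (w n t))"
  proof (intro always_eventually allI)
    fix n
    obtain t where "t \<in> I" using \<open>I \<noteq> {}\<close> by blast
    then show "0 \<le> (SUP t\<in>I. ereal (w n t))"
      using nonneg by (intro SUP_upper2) auto
  qed
  show "\<forall>\<^sub>F n in sequentially. (SUP t\<in>I. ereal (w n t)) \<le> ereal L * ?U n + ?V n"
  proof (intro always_eventually allI SUP_least)
    fix n t assume t: "t \<in> I"
    have "ereal (w n t) \<le> ereal L * ereal (u n t) + ereal (v n t)"
      using le[OF t] by simp
    also have "\<dots> \<le> ereal L * ?U n + ?V n"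
      using t \<open>L \<ge> 0\<close> by (intro add_mono ereal_mult_left_mono SUP_upper) auto
    finally show "ereal (w n t) \<le> ereal L * ?U n + ?V n" .
  qed
  have "(\<lambda>n. ereal L * ?U n + ?V n) \<longlonglongrightarrow> ereal L * 0 + 0"
    by (rule tendsto_add_ereal_general[OF _ tendsto_cmult_ereal[OF _ u] v]) simp_all
  then show "(\<lambda>n. ereal L * ?U n + ?V n) \<longlonglongrightarrow> 0"
    by simp
qed

theorem theorem2p28:
  fixes c :: complex and I :: "real set"
    and F :: "real \<times> 'x::complex_banach \<Rightarrow> 'e::complex_banach"
  assumes "cmod c = 1"
    and "I = UNIV \<or> I = {0..}"
    and "continuous_on (I \<times> UNIV) F"
    and "\<exists>L>0. \<forall>t\<in>I. \<forall>x y. norm (F (t, x) - F (t, y)) \<le> L * norm (x - y)"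
  shows "(\<forall>f :: real \<Rightarrow> 'x.
      c_uniformly_recurrent c I f \<longrightarrow>
      (\<exists>\<alpha> :: nat \<Rightarrow> real. strict_mono \<alpha> \<and> (\<forall>n. \<alpha> n > 0) \<and> filterlim \<alpha> at_top sequentially \<and>
        (\<lambda>n. SUP t\<in>I. ereal (norm (f (t + \<alpha> n) - c *\<^sub>C f t))) \<longlonglongrightarrow> 0 \<and>
        (\<lambda>n. SUP t\<in>I. ereal (norm (F (t + \<alpha> n, c *\<^sub>C f t) - c *\<^sub>C F (t, f t)))) \<longlonglongrightarrow> 0) \<longrightarrow>
      c_uniformly_recurrent c I (\<lambda>t. F (t, f t)))
    \<and> (\<forall>f :: real \<Rightarrow> 'x.
      c_almost_periodic c I f \<longrightarrow>
      (\<forall>\<epsilon>>0. relatively_dense {\<tau>. \<tau> > 0 \<and>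
        (SUP t\<in>I. ereal (norm (f (t + \<tau>) - c *\<^sub>C f t))) < ereal \<epsilon> \<and>
        (SUP t\<in>I. ereal (norm (F (t + \<tau>, c *\<^sub>C f t) - c *\<^sub>C F (t, f t)))) < ereal \<epsilon>}) \<longrightarrow>
      c_almost_periodic c I (\<lambda>t. F (t, f t)))"
proof -
  obtain L where L: "L > 0"
    and lip: "\<forall>t\<in>I. \<forall>x y. norm (F (t, x) - F (t, y)) \<le> L * norm (x - y)"
    using assms(4) by blast
  have ne: "I \<noteq> {}" and shift: "\<And>t \<tau>. t \<in> I \<Longrightarrow> \<tau> > 0 \<Longrightarrow> t + \<tau> \<in> I"
    using assms(2) by auto
  have key: "norm (F (t + \<tau>, f (t + \<tau>)) - c *\<^sub>C F (t, f t))
      \<le> L * norm (f (t + \<tau>) - c *\<^sub>C f t) + norm (F (t + \<tau>, c *\<^sub>C f t) - c *\<^sub>C F (t, f t))"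
    if "t \<in> I" "\<tau> > 0" for f :: "real \<Rightarrow> 'x" and t \<tau>
    using lip shift[OF that] by (intro norm_superposition_shift_le) blast
  show ?thesis
  proof (intro conjI allI impI)
    fix f :: "real \<Rightarrow> 'x"
    assume f: "c_uniformly_recurrent c I f"
    assume "\<exists>\<alpha> :: nat \<Rightarrow> real. strict_mono \<alpha> \<and> (\<forall>n. \<alpha> n > 0) \<and> filterlim \<alpha> at_top sequentially \<and>
        (\<lambda>n. SUP t\<in>I. ereal (norm (f (t + \<alpha> n) - c *\<^sub>C f t))) \<longlonglongrightarrow> 0 \<and>
        (\<lambda>n. SUP t\<in>I. ereal (norm (F (t + \<alpha> n, c *\<^sub>C f t) - c *\<^sub>C F (t, f t)))) \<longlonglongrightarrow> 0"
    then obtain \<alpha> :: "nat \<Rightarrow> real" where \<alpha>: "strict_mono \<alpha>" "\<forall>n. \<alpha> n > 0"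
        "filterlim \<alpha> at_top sequentially"
      and f_lim: "(\<lambda>n. SUP t\<in>I. ereal (norm (f (t + \<alpha> n) - c *\<^sub>C f t))) \<longlonglongrightarrow> 0"
      and F_lim: "(\<lambda>n. SUP t\<in>I. ereal (norm (F (t + \<alpha> n, c *\<^sub>C f t) - c *\<^sub>C F (t, f t)))) \<longlonglongrightarrow> 0"
      by blast
    have "(\<lambda>n. SUP t\<in>I. ereal (norm (F (t + \<alpha> n, f (t + \<alpha> n)) - c *\<^sub>C F (t, f t)))) \<longlonglongrightarrow> 0"
      using L key \<alpha>(2)
      by (intro tendsto_SUP_zero_of_le_lincomb[OF ne _ _ _ f_lim F_lim, where L = L]) auto
    moreover have "continuous_on I (\<lambda>t. F (t, f t))"
      using f by (intro continuous_on_superposition[OF assms(3)]) (simp add: c_uniformly_recurrent_def)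
    ultimately show "c_uniformly_recurrent c I (\<lambda>t. F (t, f t))"
      using \<alpha> unfolding c_uniformly_recurrent_def by blast
  next
    fix f :: "real \<Rightarrow> 'x"
    let ?P = "\<lambda>\<epsilon>. {\<tau>. \<tau> > 0 \<and>
        (SUP t\<in>I. ereal (norm (f (t + \<tau>) - c *\<^sub>C f t))) < ereal \<epsilon> \<and>
        (SUP t\<in>I. ereal (norm (F (t + \<tau>, c *\<^sub>C f t) - c *\<^sub>C F (t, f t)))) < ereal \<epsilon>}"
    assume f: "c_almost_periodic c I f"
      and dense: "\<forall>\<epsilon>>0. relatively_dense (?P \<epsilon>)"
    have "relatively_dense {\<tau>. \<tau> > 0 \<and>
        (\<forall>t\<in>I. norm (F (t + \<tau>, f (t + \<tau>)) - c *\<^sub>C F (t, f t)) \<le> \<epsilon>)}" if "\<epsilon> > 0" for \<epsilon>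
    proof (rule relatively_dense_mono)
      define \<delta> where "\<delta> = \<epsilon> / (L + 1)"
      have \<delta>_pos: "\<delta> > 0"
        using L that by (simp add: \<delta>_def)
      have "(L + 1) * \<delta> = \<epsilon>"
        using L by (simp add: \<delta>_def)
      then have \<delta>_sum: "L * \<delta> + \<delta> = \<epsilon>"
        by (simp add: distrib_right)
      show "relatively_dense (?P \<delta>)"
        using dense \<delta>_pos by blast
      have "norm (F (t + \<tau>, f (t + \<tau>)) - c *\<^sub>C F (t, f t)) \<le> \<epsilon>"
        if \<tau>: "\<tau> \<in> ?P \<delta>" and t: "t \<in> I" for t \<tau>
      proof -
        have less: "u t < \<delta>" if "(SUP t\<in>I. ereal (u t)) < ereal \<delta>" for u
          using SUP_lessD[OF that t] by simp
        have "norm (f (t + \<tau>) - c *\<^sub>C f t) < \<delta>"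
          by (rule less[of "\<lambda>t. norm (f (t + \<tau>) - c *\<^sub>C f t)"]) (use \<tau> in simp)
        moreover have "norm (F (t + \<tau>, c *\<^sub>C f t) - c *\<^sub>C F (t, f t)) < \<delta>"
          by (rule less[of "\<lambda>t. norm (F (t + \<tau>, c *\<^sub>C f t) - c *\<^sub>C F (t, f t))"])
            (use \<tau> in simp)
        ultimately have "L * norm (f (t + \<tau>) - c *\<^sub>C f t)
            + norm (F (t + \<tau>, c *\<^sub>C f t) - c *\<^sub>C F (t, f t)) \<le> L * \<delta> + \<delta>"
          using L by (intro add_mono mult_left_mono) auto
        then show ?thesis
          using key[OF t, of \<tau> f] \<tau> \<delta>_sum by auto
      qed
      then show "?P \<delta> \<subseteq> {\<tau>. \<tau> > 0 \<and>
          (\<forall>t\<in>I. norm (F (t + \<tau>, f (t + \<tau>)) - c *\<^sub>C F (t, f t)) \<le> \<epsilon>)}"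
        by blast
    qed auto
    moreover have "continuous_on I (\<lambda>t. F (t, f t))"
      using f by (intro continuous_on_superposition[OF assms(3)]) (simp add: c_almost_periodic_def)
    ultimately show "c_almost_periodic c I (\<lambda>t. F (t, f t))"
      unfolding c_almost_periodic_def by blast
  qed
qed

end
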